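(* Let $a$, $b$, $c$ and $r \geq 5$ be positive integers. Assume that $$ab \geq 2^r\, r^{\frac{7r}{r-4}}\, c^{\,2+\frac{r^2+r+2}{r(r-4)}}.$$ Then the inequality $$0<|a x^r - b y^r| \leq c$$ has at most $3$ primitive solutions in positive integers $x$ and $y$.
   Context: A solution $(x,y)\in\mathbb{Z}^2$ is called primitive if $\gcd(x,y)=1$. *)

theory Defs
  imports Complex_Main
begin

definition primitive :: "int \<times> int \<Rightarrow> bool" where
  "primitive = (\<lambda>(x, y). gcd x y = 1)"

end

theory Submission
  imports Defs "HOL-Computational_Algebra.Formal_Power_Series"
begin

text \<open>Put \<open>X = a\<^sup>1\<^sup>/\<^sup>r x\<close> and \<open>Y = b\<^sup>1\<^sup>/\<^sup>r y\<close>, so that a solution is a pair with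
\<open>\<bar>X\<^sup>r - Y\<^sup>r\<bar> \<le> c\<close>, and call \<open>max X Y\<close> its height. A solution of height \<open>m\<close> satisfies
\<open>\<bar>X - Y\<bar> \<le> c / m\<^sup>r\<^sup>-\<^sup>1\<close>. For two different primitive solutions the determinant
\<open>X Y' - X' Y = (ab)\<^sup>1\<^sup>/\<^sup>r (x y' - x' y)\<close> is at least \<open>H = (ab)\<^sup>1\<^sup>/\<^sup>r\<close> in absolute value, and this
forces the gap \<open>H m\<^sup>r\<^sup>-\<^sup>1 \<le> 2 c m'\<close> between their heights \<open>m \<le> m'\<close> (\<open>gap_principle\<close>).
The smallest height is at least the square root of \<open>H\<close>, so after two gaps the hypothesis on \<open>ab\<close>
makes the third height enormous compared with \<open>q = 8 r c\<close> (\<open>third_height_large\<close>).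

It remains to show that no solution \<open>(X', Y')\<close> of height \<open>T\<close> lies beyond a solution \<open>(X, Y)\<close> that
is this large (\<open>no_solution_beyond_large_solution\<close>); by symmetry \<open>X < Y\<close>. This is the hypergeometric method of
Thue and Siegel. Put \<open>w = (Y / X)\<^sup>r\<close>, which is a rational number extremely close to 1. The diagonal
Pade approximants \<open>A\<^sub>n\<close>, \<open>B\<^sub>n\<close> of \<open>w\<^sup>1\<^sup>/\<^sup>r\<close> at 1 have degree \<open>n\<close> and satisfy
\<open>B\<^sub>n w\<^sup>1\<^sup>/\<^sup>r - A\<^sub>n = R\<^sub>n\<close> with \<open>R\<^sub>n\<close> of the exact order \<open>(w - 1)\<^sup>2\<^sup>n\<^sup>+\<^sup>1\<close>; after multiplication by
\<open>r\<^sup>2\<^sup>n\<close> their coefficients are integers. Hence \<open>r\<^sup>2\<^sup>n X\<^sup>r\<^sup>n\<^sup>+\<^sup>1\<close> times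
\<open>(Y' - X') A\<^sub>n - X' R\<^sub>n\<close> is \<open>H D\<close> with an integer \<open>D\<close>. If \<open>D \<noteq> 0\<close>, then one of the two terms
cannot be small, and this gives a lower bound for \<open>T\<close>, roughly \<open>X\<^sup>r\<^sup>(\<^sup>n\<^sup>+\<^sup>1\<^sup>)\<^sup>-\<^sup>1\<close>. If \<open>D = 0\<close>, then
\<open>\<bar>Y' - X'\<bar> A\<^sub>n = X' R\<^sub>n\<close>, and the lower bound for \<open>R\<^sub>n\<close> gives an upper bound for \<open>T\<close>, roughly
\<open>X\<^sup>2\<^sup>n\<^sup>+\<^sup>1\<close>, which contradicts the lower bound already obtained from \<open>n - 1\<close>. By
induction \<open>T\<close> exceeds all these lower bounds, which is absurd.

The factor \<open>r\<^sup>2\<^sup>n\<close> and the crude estimates of the approximants suffice because each step from \<open>n - 1\<close>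
to \<open>n\<close> multiplies the bound by about \<open>X\<^sup>r\<close>, and \<open>X \<ge> q\<^sup>8\<close> absorbs any small power of \<open>q\<close>.\<close>

unbundle fps_syntax

section \<open>Integrality of scaled binomial coefficients at rational points\<close>

lemma fps_power_nth_Ints:
  fixes h :: "real fps"
  assumes "\<And>i. i < k \<Longrightarrow> h $ i \<in> \<int>" "i < k"
  shows "(h ^ j) $ i \<in> \<int>"
  using assms(2)
proof (induction j arbitrary: i)
  case 0
  then show ?case by (simp add: fps_one_nth)
next
  case (Suc j)
  show ?case unfolding power_Suc fps_mult_nth
    using Suc assms(1) by (intro Ints_sum Ints_mult) auto
qed

text \<open>With vanishing constant term, the \<open>k\<close>-th coefficient of a power of exponent at least 2 involves only
the coefficients of \<open>h\<close> below \<open>k\<close>. This is what makes the recursion for an \<open>r\<close>-th root work.\<close>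

lemma fps_power_nth_Ints_diag:
  fixes h :: "real fps"
  assumes "\<And>i. i < k \<Longrightarrow> h $ i \<in> \<int>" "h $ 0 = 0" "j \<ge> 2"
  shows "(h ^ j) $ k \<in> \<int>"
proof -
  obtain m where m: "j = Suc (Suc m)" using assms(3) by (metis add_2_eq_Suc le_Suc_ex)
  have "h $ i * (h ^ Suc m) $ (k - i) \<in> \<int>" if "i \<le> k" for i
  proof -
    consider "i = 0" | "i = k" | "0 < i" "i < k" using \<open>i \<le> k\<close> by linarith
    then show ?thesis
    proof cases
      case 2
      then show ?thesis using assms(2) by simp
    next
      case 3
      then show ?thesis using assms(1) by (intro Ints_mult fps_power_nth_Ints[of k]) auto
    qed (use assms(2) in simp)
  qed
  then show ?thesis unfolding m power_Suc[of h "Suc m"] fps_mult_nth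
    by (intro Ints_sum) auto
qed

text \<open>Write \<open>F = 1 + r h\<close>. In the binomial expansion of \<open>(1 + r h)\<^sup>r\<close> the linear term is \<open>r\<^sup>2 h\<close> and all later
terms are divisible by \<open>r\<^sup>2\<close>, so that after division by \<open>r\<^sup>2\<close> the equation determines each coefficient
of \<open>h\<close> as an integer polynomial in the earlier ones.\<close>

lemma fps_root_nth_Ints:
  fixes F :: "real fps"
  assumes F0: "F $ 0 = 1" and r: "r > 0"
    and Fr: "F ^ r = 1 + fps_const (real r ^ 2) * fps_X"
  shows "F $ k \<in> \<int>"
proof -
  define h where "h = fps_const (1 / real r) * (F - 1)"
  have h0: "h $ 0 = 0" by (simp add: h_def F0)
  have Fh: "F = fps_const (real r) * h + 1"
    using r by (simp add: h_def mult.assoc[symmetric])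
  have h: "h $ k \<in> \<int>" for k
  proof (induction k rule: less_induct)
    case (less k)
    show ?case
    proof (cases "k = 0")
      case False
      define c where "c j = real (r choose j) * real r ^ j * (h ^ j) $ k" for j
      have "F ^ r = (\<Sum>j\<le>r. of_nat (r choose j) * (fps_const (real r) * h) ^ j)"
        unfolding Fh by (subst binomial_ring) simp
      also have "\<dots> $ k = (\<Sum>j\<le>r. c j)"
        unfolding fps_sum_nth c_def
        by (intro sum.cong)
          (simp_all add: power_mult_distrib fps_of_nat[symmetric] mult.assoc)
      also have "\<dots> = (\<Sum>j\<in>{0,1} \<union> {2..r}. c j)"
        using r by (intro sum.cong) auto
      also have "\<dots> = c 0 + c 1 + (\<Sum>j=2..r. c j)"
        by (subst sum.union_disjoint) auto
      also have "c 0 = 0" using False by (simp add: c_def fps_one_nth)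
      also have "c 1 = real r ^ 2 * h $ k" by (simp add: c_def power2_eq_square)
      also have "(\<Sum>j=2..r. c j)
                 = real r ^ 2 * (\<Sum>j=2..r. real (r choose j) * real r ^ (j - 2) * (h ^ j) $ k)"
        unfolding sum_distrib_left c_def
        using power_add[of "real r" 2]
        by (intro sum.cong) (auto simp: le_iff_add)
      finally have "real r ^ 2 * (h $ k) = real r ^ 2 * ((if k = 1 then 1 else 0)
           - (\<Sum>j=2..r. real (r choose j) * real r ^ (j - 2) * (h ^ j) $ k))"
        using False by (simp add: Fr fps_one_nth fps_X_nth algebra_simps)
      then have "h $ k = (if k = 1 then 1 else 0)
           - (\<Sum>j=2..r. real (r choose j) * real r ^ (j - 2) * (h ^ j) $ k)"
        using r by simp
      also have "\<dots> \<in> \<int>"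
        using less h0 by (intro Ints_diff Ints_sum Ints_mult Ints_power fps_power_nth_Ints_diag) auto
      finally show ?thesis .
    qed (simp add: h0)
  qed
  show ?thesis by (subst Fh) (auto simp: fps_one_nth intro!: Ints_add Ints_mult h)
qed

text \<open>These numbers are the coefficients of \<open>(1 + r\<^sup>2 X)\<^sup>m\<^sup>/\<^sup>r\<close>, the \<open>m\<close>-th power of the integral
series \<open>(1 + r\<^sup>2 X)\<^sup>1\<^sup>/\<^sup>r\<close>.\<close>

lemma gbinomial_rational_Ints:
  assumes "r > 0"
  shows "real r ^ (2 * k) * ((real m / real r) gchoose k) \<in> \<int>"
proof -
  define F where "F = fps_binomial (1 / real r) oo (fps_const (real r ^ 2) * fps_X)"
  have pow: "F ^ m = fps_binomial (real m / real r) oo (fps_const (real r ^ 2) * fps_X)" for m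
    unfolding F_def by (subst fps_compose_power) (simp_all add: fps_binomial_power)
  have "F ^ r = 1 + fps_const (real r ^ 2) * fps_X"
    using assms by (simp add: pow fps_binomial_1 fps_compose_add_distrib)
  moreover have "F $ 0 = 1" by (simp add: F_def)
  ultimately have "F $ k \<in> \<int>" for k using fps_root_nth_Ints assms by blast
  then have "(F ^ m) $ k \<in> \<int>" by (intro fps_power_nth_Ints[of "Suc k"]) auto
  then show ?thesis by (simp add: pow fps_compose_linear power_mult)
qed

section \<open>Pade approximants of the binomial function\<close>

text \<open>For natural \<open>\<beta>\<close> both sides count the ways to choose disjoint sets of sizes \<open>i\<close> and \<open>j\<close> from \<open>\<beta>\<close> objects.\<close>

lemma gbinomial_shifted_product:
  fixes \<beta> :: real
  shows "(\<beta> gchoose i) * ((\<beta> - real i) gchoose j) = (\<beta> gchoose j) * ((\<beta> - real j) gchoose i)"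
proof -
  have "(of_nat (i + j) gchoose i) = (of_nat (i + j) gchoose j :: real)"
    using binomial_symmetric[of i "i + j"] by (simp only: binomial_gbinomial[symmetric]) simp
  then have "(\<beta> gchoose (i + j)) * (of_nat (i + j) gchoose i) = (\<beta> gchoose (i + j)) * (of_nat (i + j) gchoose j)"
    by (rule arg_cong)
  then show ?thesis
    unfolding gbinomial_trinomial_revision[OF le_add1[of i j]] gbinomial_trinomial_revision[OF le_add2[of j i]]
    by simp
qed

text \<open>The polynomials \<open>pade n \<alpha>\<close> and \<open>pade n (-\<alpha>)\<close> are the numerator and the denominator of the diagonal Pade
approximant of order \<open>n\<close> to \<open>w powr \<alpha>\<close> at \<open>w = 1\<close>. In powers of \<open>w\<close>, rather than of \<open>w - 1\<close>, the
two are exchanged by \<open>\<alpha> \<mapsto> -\<alpha>\<close>, their coefficients are positive for \<open>\<bar>\<alpha>\<bar> < 1\<close>, and the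
derivatives of \<open>w powr \<alpha> * pade n (-\<alpha>) w\<close> are again sums of powers of \<open>w\<close>.\<close>

definition pade_coeff :: "nat \<Rightarrow> real \<Rightarrow> nat \<Rightarrow> real" where
  "pade_coeff n \<alpha> k = ((real n + \<alpha>) gchoose k) * ((real n - \<alpha>) gchoose (n - k))"

definition pade :: "nat \<Rightarrow> real \<Rightarrow> real \<Rightarrow> real" where
  "pade n \<alpha> w = (\<Sum>k\<le>n. pade_coeff n \<alpha> k * w ^ k)"

text \<open>Up to the factor \<open>j!\<close> this is the \<open>j\<close>-th derivative of the numerator at 1. The next lemma gives the
same value for \<open>w powr \<alpha>\<close> times the denominator; hence the two functions agree at 1 to order \<open>n\<close>.
Both are instances of the Vandermonde convolution.\<close>

lemma pade_coeff_moment: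
  assumes "j \<le> n"
  shows "(\<Sum>k\<le>n. pade_coeff n \<alpha> k * (real k gchoose j))
           = ((real n + \<alpha>) gchoose j) * (real (2 * n - j) gchoose (n - j))"
proof -
  have "(\<Sum>k\<le>n. pade_coeff n \<alpha> k * (real k gchoose j))
        = (\<Sum>k=j..n. pade_coeff n \<alpha> k * (real k gchoose j))"
    by (rule sum.mono_neutral_right) (auto simp: binomial_gbinomial[symmetric])
  also have "\<dots> = (\<Sum>k=j..n. ((real n + \<alpha>) gchoose j) *
                 (((real n + \<alpha> - real j) gchoose (k - j)) * ((real n - \<alpha>) gchoose (n - k))))"
    unfolding pade_coeff_def
    using gbinomial_trinomial_revision[of j _ "real n + \<alpha>"]
    by (intro sum.cong) (auto simp: algebra_simps)
  also have "\<dots> = ((real n + \<alpha>) gchoose j) * (\<Sum>k\<le>n-j.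
                 ((real n + \<alpha> - real j) gchoose k) * ((real n - \<alpha>) gchoose (n - j - k)))"
    unfolding sum_distrib_left
    by (rule sum.reindex_bij_witness[of _ "\<lambda>k. k + j" "\<lambda>k. k - j"]) (use assms in auto)
  also have "\<dots> = ((real n + \<alpha>) gchoose j) * (real (2 * n - j) gchoose (n - j))"
    using gbinomial_Vandermonde[of "real n + \<alpha> - real j" "real n - \<alpha>" "n - j"] assms
    by (simp add: atLeast0AtMost of_nat_diff)
  finally show ?thesis .
qed

lemma pade_coeff_minus_moment:
  assumes "j \<le> n"
  shows "(\<Sum>k\<le>n. pade_coeff n (-\<alpha>) k * ((real k + \<alpha>) gchoose j))
           = ((real n + \<alpha>) gchoose j) * (real (2 * n - j) gchoose (n - j))"
proof -
  have "(\<Sum>k\<le>n. pade_coeff n (-\<alpha>) k * ((real k + \<alpha>) gchoose j))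
        = (\<Sum>k\<le>n. ((real n + \<alpha>) gchoose j) *
            (((real n - \<alpha>) gchoose k) * ((real n + \<alpha> - real j) gchoose (n - k))))"
  proof (intro sum.cong refl)
    fix k assume "k \<in> {..n}"
    then have "((real n + \<alpha>) gchoose (n - k)) * ((real k + \<alpha>) gchoose j)
               = ((real n + \<alpha>) gchoose j) * ((real n + \<alpha> - real j) gchoose (n - k))"
      using gbinomial_shifted_product[of "real n + \<alpha>" "n - k" j] by (simp add: of_nat_diff algebra_simps)
    then show "pade_coeff n (-\<alpha>) k * ((real k + \<alpha>) gchoose j) = ((real n + \<alpha>) gchoose j) *
            (((real n - \<alpha>) gchoose k) * ((real n + \<alpha> - real j) gchoose (n - k)))"
      by (simp add: pade_coeff_def)
  qed
  also have "\<dots> = ((real n + \<alpha>) gchoose j) * (real (2 * n - j) gchoose n)"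
    unfolding sum_distrib_left[symmetric]
    using gbinomial_Vandermonde[of "real n - \<alpha>" "real n + \<alpha> - real j" n] assms
    by (simp add: atLeast0AtMost of_nat_diff)
  also have "(real (2 * n - j) gchoose n) = (real (2 * n - j) gchoose (n - j))"
  proof -
    have "2 * n - j - n = n - j" "n \<le> 2 * n - j" using assms by auto
    then show ?thesis
      using binomial_symmetric[of n "2 * n - j"] by (simp only: binomial_gbinomial[symmetric])
  qed
  finally show ?thesis .
qed

text \<open>The constant factor of the \<open>(n + 1)\<close>-st derivative of the remainder, which equals
\<open>\<alpha> (1 - \<alpha>\<^sup>2) (4 - \<alpha>\<^sup>2) \<dots> (n\<^sup>2 - \<alpha>\<^sup>2) / n!\<close>.\<close>

definition pade_remainder_const :: "nat \<Rightarrow> real \<Rightarrow> real" where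
  "pade_remainder_const n \<alpha> = fact (Suc n) * ((real n + \<alpha>) gchoose (Suc n)) * ((real n - \<alpha>) gchoose n)"

text \<open>After \<open>n + 1\<close> differentiations the numerator has disappeared, and the coefficients that are left
from the other function are those of \<open>(w - 1)\<^sup>n\<close>: this raises the order of contact at 1 from \<open>n + 1\<close>
to \<open>2 n + 1\<close>.\<close>

lemma pade_coeff_minus_top:
  assumes "k \<le> n"
  shows "fact (Suc n) * (pade_coeff n (-\<alpha>) k * ((real k + \<alpha>) gchoose (Suc n)))
         = pade_remainder_const n \<alpha> * (real (n choose k) * (-1) ^ (n - k))"
proof -
  have 1: "((real n + \<alpha>) gchoose (n - k)) * ((real k + \<alpha>) gchoose (Suc n))
               = ((real n + \<alpha>) gchoose (Suc n)) * ((\<alpha> - 1) gchoose (n - k))"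
    using gbinomial_shifted_product[of "real n + \<alpha>" "n - k" "Suc n"] assms
    by (simp add: of_nat_diff algebra_simps)
  have 2: "((\<alpha> - 1) gchoose (n - k)) = (-1) ^ (n - k) * ((real n - \<alpha> - real k) gchoose (n - k))"
    using gbinomial_negated_upper[of "\<alpha> - 1" "n - k"] assms by (simp add: of_nat_diff algebra_simps)
  have 3: "((real n - \<alpha>) gchoose k) * ((real n - \<alpha> - real k) gchoose (n - k))
           = ((real n - \<alpha>) gchoose n) * real (n choose k)"
    using gbinomial_trinomial_revision[of k n "real n - \<alpha>"] assms
    by (simp add: binomial_gbinomial)
  have "pade_coeff n (-\<alpha>) k * ((real k + \<alpha>) gchoose (Suc n))
     = ((real n - \<alpha>) gchoose k) * (((real n + \<alpha>) gchoose (n - k)) * ((real k + \<alpha>) gchoose (Suc n)))"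
    by (simp add: pade_coeff_def)
  also have "\<dots> = ((real n + \<alpha>) gchoose (Suc n)) * (-1) ^ (n - k) *
     (((real n - \<alpha>) gchoose k) * ((real n - \<alpha> - real k) gchoose (n - k)))"
    unfolding 1 2 by (simp add: mult_ac)
  also have "\<dots> = ((real n + \<alpha>) gchoose (Suc n)) * (-1) ^ (n - k) *
     (((real n - \<alpha>) gchoose n) * real (n choose k))" unfolding 3 ..
  finally show ?thesis by (simp add: pade_remainder_const_def mult_ac)
qed

text \<open>Repeated application of Cauchy's mean value theorem to \<open>f j\<close> and a power of \<open>x - 1\<close>. Unlike the
Lagrange form of Taylor's theorem, which would leave a factor \<open>(t - 1)\<^sup>n\<close> at an unknown point \<open>t\<close>, this
keeps the full power of \<open>w - 1\<close> outside, so that it bounds \<open>f 0 w\<close> from below as well as from above.\<close>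

lemma cauchy_mean_value_chain:
  fixes f :: "nat \<Rightarrow> real \<Rightarrow> real"
  assumes deriv: "\<And>j x. j \<le> n \<Longrightarrow> x \<ge> 1 \<Longrightarrow> (f j has_real_derivative f (Suc j) x) (at x)"
    and zero: "\<And>j. j \<le> n \<Longrightarrow> f j 1 = 0"
    and top: "\<And>x. x \<ge> 1 \<Longrightarrow> f (Suc n) x = g x * (x - 1) ^ n"
    and "w > 1"
  shows "\<exists>t. 1 < t \<and> t \<le> w \<and> f 0 w * fact (2 * n + 1) = fact n * g t * (w - 1) ^ (2 * n + 1)"
proof -
  have "\<exists>t. 1 < t \<and> t \<le> w \<and> f (Suc n - m) w * fact (n + m) = fact n * g t * (w - 1) ^ (n + m)"
    if "m \<le> Suc n" "w > 1" for m w
    using that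
  proof (induction m arbitrary: w)
    case 0
    then show ?case using top[of w] by (intro exI[of _ w]) auto
  next
    case (Suc m)
    have S: "Suc n - m = Suc (n - m)" using Suc.prems by simp
    have "\<exists>c. c > 1 \<and> c < w \<and> (f (n - m) w - f (n - m) 1) * (real (Suc (n + m)) * (c - 1) ^ (n + m))
             = ((w - 1) ^ (Suc (n + m)) - (1 - 1) ^ (Suc (n + m))) * f (Suc (n - m)) c"
    proof (rule GMVT')
      show "isCont (f (n - m)) z" if "1 \<le> z" for z
        using deriv[of "n - m" z] that by (auto intro: DERIV_isCont)
      show "isCont (\<lambda>x. (x - 1) ^ Suc (n + m)) z" for z :: real
        by (intro continuous_intros)
      show "((\<lambda>x. (x - 1) ^ Suc (n + m)) has_real_derivative real (Suc (n + m)) * (z - 1) ^ (n + m)) (at z)"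
        for z :: real
      proof -
        have "((\<lambda>x. x - 1) has_real_derivative 1) (at z)"
          by (auto intro!: derivative_eq_intros)
        from DERIV_power[OF this, of "Suc (n + m)"] show ?thesis
          by (simp del: power_Suc)
      qed
      show "(f (n - m) has_real_derivative f (Suc (n - m)) z) (at z)" if "1 < z" for z
        using deriv[of "n - m" z] that by simp
    qed (use Suc.prems in simp)
    then obtain c where c: "1 < c" "c < w" and eq:
      "f (n - m) w * (real (Suc (n + m)) * (c - 1) ^ (n + m)) = (w - 1) ^ (Suc (n + m)) * f (Suc (n - m)) c"
      using zero[of "n - m"] by (auto simp del: of_nat_Suc)
    obtain t where t: "1 < t" "t \<le> c"
      and ft: "f (Suc (n - m)) c * fact (n + m) = fact n * g t * (c - 1) ^ (n + m)"
      using Suc.IH[of c] Suc.prems(1) c(1) unfolding S by (meson Suc_leD)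
    have "f (n - m) w * fact (n + Suc m) * (c - 1) ^ (n + m)
          = f (n - m) w * (real (Suc (n + m)) * (c - 1) ^ (n + m)) * fact (n + m)" 
      by (simp add: algebra_simps)
    also have "\<dots> = (w - 1) ^ (Suc (n + m)) * (f (Suc (n - m)) c * fact (n + m))"
      unfolding eq by simp
    also have "\<dots> = fact n * g t * (w - 1) ^ (n + Suc m) * (c - 1) ^ (n + m)"
      unfolding ft by simp
    finally have "f (n - m) w * fact (n + Suc m) = fact n * g t * (w - 1) ^ (n + Suc m)"
      using c by simp
    moreover have "Suc n - Suc m = n - m" "t \<le> w" using t c by simp_all
    ultimately show ?case using t(1) by metis
  qed
  moreover have "n + Suc n = 2 * n + 1" by simp
  ultimately show ?thesis using \<open>w > 1\<close> by (metis diff_self_eq_0 order_refl)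
qed

lemma DERIV_scaled_powr:
  assumes "x > 0"
  shows "((\<lambda>x. fact j * (s gchoose j) * x powr (s - real j)) has_real_derivative
           fact (Suc j) * (s gchoose (Suc j)) * x powr (s - real (Suc j))) (at x)"
proof -
  have "(s - real j) * (s gchoose j) = real (Suc j) * (s gchoose Suc j)"
    using gbinomial_mult_1[of s j] by (simp add: algebra_simps)
  then have 1: "fact (Suc j) * (s gchoose (Suc j)) = fact j * (s gchoose j) * (s - real j)"
    by (simp add: algebra_simps)
  have 2: "s - real (Suc j) = s - real j - 1" by simp
  have "((\<lambda>x. fact j * (s gchoose j) * x powr (s - real j)) has_real_derivative
           fact j * (s gchoose j) * ((s - real j) * x powr (s - real j - 1))) (at x)"
    using assms by (intro DERIV_cmult has_real_derivative_powr)
  then show ?thesis unfolding 1 2 by (simp only: mult.assoc)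
qed

lemma pade_remainder:
  assumes "w > 1"
  shows "\<exists>t. 1 < t \<and> t \<le> w \<and>
     (pade n (-\<alpha>) w * w powr \<alpha> - pade n \<alpha> w) * fact (2 * n + 1)
       = fact n * (pade_remainder_const n \<alpha> * t powr (\<alpha> - real (Suc n))) * (w - 1) ^ (2 * n + 1)"
proof -
  define P where "P s j x = fact j * (s gchoose j) * x powr (s - real j)" for s :: real and j x
  define f where "f j x = (\<Sum>k\<le>n. pade_coeff n (-\<alpha>) k * P (real k + \<alpha>) j x)
                        - (\<Sum>k\<le>n. pade_coeff n \<alpha> k * P (real k) j x)" for j x
  have "\<exists>t. 1 < t \<and> t \<le> w \<and> f 0 w * fact (2 * n + 1)
       = fact n * (pade_remainder_const n \<alpha> * t powr (\<alpha> - real (Suc n))) * (w - 1) ^ (2 * n + 1)"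
  proof (rule cauchy_mean_value_chain[where f = f and g = "\<lambda>t. pade_remainder_const n \<alpha> * t powr (\<alpha> - real (Suc n))"])
    fix j and x :: real assume "x \<ge> 1"
    then have "(P s j has_real_derivative P s (Suc j) x) (at x)" for s
      unfolding P_def by (intro DERIV_scaled_powr) simp
    then show "(f j has_real_derivative f (Suc j) x) (at x)"
      unfolding f_def by (intro DERIV_diff DERIV_sum DERIV_cmult)
  next
    fix j assume j: "j \<le> n"
    have "f j 1 = fact j * ((\<Sum>k\<le>n. pade_coeff n (-\<alpha>) k * ((real k + \<alpha>) gchoose j))
                    - (\<Sum>k\<le>n. pade_coeff n \<alpha> k * (real k gchoose j)))"
      unfolding f_def P_def by (simp add: right_diff_distrib sum_distrib_left mult_ac)
    then show "f j 1 = 0" unfolding pade_coeff_moment[OF j] pade_coeff_minus_moment[OF j] by simp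
  next
    fix x :: real assume x: "x \<ge> 1"
    have "(\<Sum>k\<le>n. pade_coeff n \<alpha> k * P (real k) (Suc n) x) = 0"
      unfolding P_def by (intro sum.neutral) (auto simp: binomial_gbinomial[symmetric])
    moreover have "(\<Sum>k\<le>n. pade_coeff n (-\<alpha>) k * P (real k + \<alpha>) (Suc n) x)
       = (\<Sum>k\<le>n. pade_remainder_const n \<alpha> * x powr (\<alpha> - real (Suc n)) * (real (n choose k) * x ^ k * (-1) ^ (n - k)))"
    proof (intro sum.cong refl)
      fix k assume "k \<in> {..n}"
      then have top: "fact (Suc n) * (pade_coeff n (-\<alpha>) k * ((real k + \<alpha>) gchoose (Suc n)))
         = pade_remainder_const n \<alpha> * (real (n choose k) * (-1) ^ (n - k))"
        by (intro pade_coeff_minus_top) simp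
      have "real k + \<alpha> - real (Suc n) = (\<alpha> - real (Suc n)) + real k" by simp
      then have "pade_coeff n (-\<alpha>) k * P (real k + \<alpha>) (Suc n) x
         = (fact (Suc n) * (pade_coeff n (-\<alpha>) k * ((real k + \<alpha>) gchoose (Suc n))))
             * x powr ((\<alpha> - real (Suc n)) + real k)"
        unfolding P_def by (simp only: mult_ac)
      also have "\<dots> = pade_remainder_const n \<alpha> * (real (n choose k) * (-1) ^ (n - k))
             * x powr ((\<alpha> - real (Suc n)) + real k)"
        unfolding top ..
      also have "x powr ((\<alpha> - real (Suc n)) + real k) = x powr (\<alpha> - real (Suc n)) * x ^ k"
        using x by (simp add: powr_add powr_realpow)
      finally show "pade_coeff n (-\<alpha>) k * P (real k + \<alpha>) (Suc n) x
         = pade_remainder_const n \<alpha> * x powr (\<alpha> - real (Suc n)) * (real (n choose k) * x ^ k * (-1) ^ (n - k))"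
        by (simp add: mult_ac)
    qed
    ultimately show "f (Suc n) x = pade_remainder_const n \<alpha> * x powr (\<alpha> - real (Suc n)) * (x - 1) ^ n"
      using binomial_ring[of x "-1" n] by (simp add: f_def sum_distrib_left)
  qed (rule assms)
  moreover have "f 0 w = pade n (-\<alpha>) w * w powr \<alpha> - pade n \<alpha> w"
    using assms unfolding f_def P_def pade_def sum_distrib_right
    by (simp add: powr_add powr_realpow mult_ac)
  ultimately show ?thesis by simp
qed

section \<open>Size and integrality of the approximants\<close>

lemma gbinomial_nonneg:
  fixes x :: real
  assumes "x + 1 \<ge> real k"
  shows "x gchoose k \<ge> 0"
  unfolding gbinomial_prod_rev using assms
  by (intro divide_nonneg_nonneg prod_nonneg) auto

lemma pade_coeff_nonneg:
  assumes "\<bar>\<alpha>\<bar> \<le> 1" "k \<le> n"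
  shows "pade_coeff n \<alpha> k \<ge> 0"
  unfolding pade_coeff_def using assms
  by (intro mult_nonneg_nonneg gbinomial_nonneg) (auto simp: of_nat_diff)

lemma pade_nonneg:
  assumes "\<bar>\<alpha>\<bar> \<le> 1" "w \<ge> 0"
  shows "pade n \<alpha> w \<ge> 0"
  unfolding pade_def using assms by (intro sum_nonneg mult_nonneg_nonneg pade_coeff_nonneg) auto

text \<open>The coefficients are nonnegative, and their sum is the central binomial coefficient, which is at
most \<open>4\<^sup>n\<close>.\<close>

lemma pade_upper:
  assumes "\<bar>\<alpha>\<bar> \<le> 1" "1 \<le> w" "w \<le> 2"
  shows "pade n \<alpha> w \<le> 8 ^ n"
proof -
  have "pade n \<alpha> w \<le> (\<Sum>k\<le>n. pade_coeff n \<alpha> k * 2 ^ n)"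
    unfolding pade_def
  proof (intro sum_mono mult_left_mono pade_coeff_nonneg)
    fix k assume "k \<in> {..n}"
    then have "w ^ k \<le> 2 ^ k" "(2::real) ^ k \<le> 2 ^ n" using assms by (auto intro: power_mono)
    then show "w ^ k \<le> 2 ^ n" by linarith
  qed (use assms in auto)
  also have "\<dots> = real (2 * n choose n) * 2 ^ n"
    using pade_coeff_moment[of 0 n \<alpha>]
    by (simp add: sum_distrib_right[symmetric] binomial_gbinomial)
  also have "real (2 * n choose n) \<le> real (2 ^ (2 * n))"
    using binomial_le_pow2[of "2 * n" n] of_nat_le_iff by blast
  also have "real (2 ^ (2 * n)) * 2 ^ n = 8 ^ n"
    by (simp add: power_mult power_mult_distrib[symmetric])
  finally show ?thesis by simp
qed

lemma pade_remainder_const_pochhammer: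
  "pade_remainder_const n \<alpha> = pochhammer \<alpha> (Suc n) * pochhammer (1 - \<alpha>) n / fact n"
  using gbinomial_pochhammer'[of "real n + \<alpha>" "Suc n"] gbinomial_pochhammer'[of "real n - \<alpha>" n]
  by (simp add: pade_remainder_const_def add.commute[of 1] del: fact_Suc pochhammer_Suc)

lemma pade_remainder_const_upper:
  assumes "0 < \<alpha>" "\<alpha> < 1"
  shows "pade_remainder_const n \<alpha> \<le> fact (Suc n)"
proof -
  have 1: "pochhammer \<alpha> (Suc n) \<le> fact (Suc n)"
    unfolding pochhammer_fact unfolding pochhammer_prod using assms by (intro prod_mono) auto
  have 2: "pochhammer (1 - \<alpha>) n \<le> fact n"
    unfolding pochhammer_fact unfolding pochhammer_prod using assms by (intro prod_mono) auto
  have "pochhammer \<alpha> (Suc n) * pochhammer (1 - \<alpha>) n \<le> fact (Suc n) * fact n"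
    using 1 2 assms by (intro mult_mono pochhammer_nonneg) (auto simp: pochhammer_prod intro!: prod_nonneg)
  then show ?thesis unfolding pade_remainder_const_pochhammer by (simp add: divide_le_eq del: fact_Suc)
qed

lemma pade_remainder_const_lower:
  assumes "0 < \<alpha>" "\<alpha> \<le> 1 / 2"
  shows "\<alpha> * fact n / 2 ^ n \<le> pade_remainder_const n \<alpha>"
proof -
  have "fact n \<le> pochhammer (\<alpha> + 1) n"
    unfolding pochhammer_fact unfolding pochhammer_prod using assms by (intro prod_mono) auto
  then have 1: "\<alpha> * fact n \<le> pochhammer \<alpha> (Suc n)"
    unfolding pochhammer_rec using assms by simp
  have "fact n / 2 ^ n = (\<Prod>i = 0..<n. (1 + real i) / 2)"
    unfolding pochhammer_fact unfolding pochhammer_prod by (simp add: prod_dividef)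
  also have "\<dots> \<le> pochhammer (1 - \<alpha>) n"
    unfolding pochhammer_prod using assms by (intro prod_mono) (auto simp: field_simps)
  finally have 2: "fact n / 2 ^ n \<le> pochhammer (1 - \<alpha>) n" .
  have "(\<alpha> * fact n) * (fact n / 2 ^ n) \<le> pochhammer \<alpha> (Suc n) * pochhammer (1 - \<alpha>) n"
    using assms by (intro mult_mono 1 2 pochhammer_nonneg) auto
  then show ?thesis unfolding pade_remainder_const_pochhammer by (simp add: field_simps)
qed

lemma fact_odd_le: "(fact (2 * n + 1) :: real) \<le> 2 ^ (3 * n + 1) * (fact n * fact n)"
proof (induction n)
  case (Suc n)
  have "(fact (2 * Suc n + 1) :: real) = (2 * real n + 3) * (2 * real n + 2) * fact (2 * n + 1)"
    by (simp add: algebra_simps)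
  also have "\<dots> \<le> (8 * (real n + 1) * (real n + 1)) * (2 ^ (3 * n + 1) * (fact n * fact n))"
  proof (rule mult_mono[OF _ Suc.IH])
    show "(2 * real n + 3) * (2 * real n + 2) \<le> 8 * (real n + 1) * (real n + 1)"
      by (simp add: algebra_simps)
  qed auto
  also have "\<dots> = 2 ^ (3 * Suc n + 1) * (fact (Suc n) * fact (Suc n))"
    by (simp add: algebra_simps power_add)
  finally show ?case .
qed simp

text \<open>The lower bound is needed as much as the upper one: it is what excludes that a later solution
coincides with an approximant.\<close>

lemma pade_remainder_bounds:
  fixes n :: nat and \<alpha> w :: real
  assumes \<alpha>: "0 < \<alpha>" "\<alpha> \<le> 1 / 2" and w: "1 < w" "w \<le> 2"
  defines "R \<equiv> pade n (-\<alpha>) w * w powr \<alpha> - pade n \<alpha> w"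
  shows "R \<le> (w - 1) ^ (2 * n + 1)" "\<alpha> / 2 ^ (5 * n + 2) * (w - 1) ^ (2 * n + 1) \<le> R"
proof -
  define z where "z = (w - 1) ^ (2 * n + 1)"
  have z: "z > 0" using w by (simp add: z_def)
  obtain t where t: "1 < t" "t \<le> w" and eq: "R * fact (2 * n + 1)
       = fact n * (pade_remainder_const n \<alpha> * t powr (\<alpha> - real (Suc n))) * z"
    using pade_remainder[OF w(1)] unfolding R_def z_def by blast
  define p where "p = t powr (\<alpha> - real (Suc n))"
  have p1: "p \<le> 1" using t powr_mono[of "\<alpha> - real (Suc n)" 0 t] \<alpha> by (simp add: p_def)
  have "p = inverse (t powr (real (Suc n) - \<alpha>))" by (simp add: p_def powr_minus[symmetric])
  moreover have "t powr (real (Suc n) - \<alpha>) \<le> 2 ^ Suc n"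
  proof -
    have "t powr (real (Suc n) - \<alpha>) \<le> t powr (real (Suc n))" using t \<alpha> by (intro powr_mono) auto
    also have "\<dots> = t ^ Suc n" using t by (intro powr_realpow) simp
    also have "\<dots> \<le> 2 ^ Suc n" using t w by (intro power_mono) auto
    finally show ?thesis .
  qed
  ultimately have p2: "1 / 2 ^ Suc n \<le> p"
    using t by (simp add: inverse_eq_divide frac_le del: power_Suc of_nat_Suc)
  have K0: "0 \<le> pade_remainder_const n \<alpha>" 
    by (rule order_trans[OF _ pade_remainder_const_lower]) (use \<alpha> in auto)
  have "R * fact (2 * n + 1) \<le> fact n * (fact (Suc n) * 1) * z"
    unfolding eq p_def[symmetric] using pade_remainder_const_upper[of \<alpha> n] \<alpha> z p1 K0
    by (intro mult_right_mono mult_left_mono mult_mono) (auto simp: p_def)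
  also have "(fact n * (fact (Suc n) * 1) :: real) \<le> fact (2 * n + 1)"
  proof -
    have "fact n * fact (Suc n) \<le> (fact (n + Suc n) :: nat)"
      using fact_fact_dvd_fact[of n "Suc n", where 'a = nat] by (rule dvd_imp_le) simp
    then have "real (fact n * fact (Suc n)) \<le> real (fact (n + Suc n))" by (rule of_nat_mono)
    then show ?thesis by (simp add: mult_2 del: fact_Suc)
  qed
  finally show "R \<le> (w - 1) ^ (2 * n + 1)" unfolding z_def[symmetric] using z by simp
  have "(\<alpha> / 2 ^ (5 * n + 2) * z) * fact (2 * n + 1)
      \<le> (\<alpha> / 2 ^ (5 * n + 2) * z) * (2 ^ (3 * n + 1) * (fact n * fact n))"
    using \<alpha> z by (intro mult_left_mono fact_odd_le) auto
  also have "\<dots> = fact n * ((\<alpha> * fact n / 2 ^ n) * (1 / 2 ^ Suc n)) * z"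
  proof -
    have "(2::real) ^ (5 * n + 2) = 2 ^ (3 * n + 1) * (2 ^ n * 2 ^ Suc n)"
      by (simp flip: power_add)
    then show ?thesis by (simp add: field_simps)
  qed
  also have "\<dots> \<le> fact n * (pade_remainder_const n \<alpha> * p) * z"
    using pade_remainder_const_lower[of \<alpha> n] \<alpha> z p2 K0
    by (intro mult_right_mono mult_left_mono mult_mono) auto
  also have "\<dots> = R * fact (2 * n + 1)" unfolding eq p_def ..
  finally show "\<alpha> / 2 ^ (5 * n + 2) * (w - 1) ^ (2 * n + 1) \<le> R"
    unfolding z_def[symmetric] using fact_gt_zero by (rule mult_right_le_imp_le)
qed

text \<open>The \<open>k\<close>-th coefficient is a product of binomial coefficients of lower indices \<open>k\<close> and \<open>n - k\<close> at
\<open>(r n \<plusminus> 1) / r\<close>, so the powers \<open>r\<^sup>2\<^sup>k\<close> and \<open>r\<^sup>2\<^sup>(\<^sup>n\<^sup>-\<^sup>k\<^sup>)\<close> that make the factors integral combine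
to a power independent of \<open>k\<close>.\<close>

lemma pade_Ints:
  fixes U V :: int
  assumes r: "r > 0" and n: "n > 0" and U: "U > 0"
    and \<alpha>: "\<alpha> = 1 / real r \<or> \<alpha> = - (1 / real r)"
  shows "real r ^ (2 * n) * (of_int U ^ n * pade n \<alpha> (of_int V / of_int U)) \<in> \<int>"
proof -
  have rn: "1 \<le> r * n" using r n by (simp add: Suc_le_eq)
  have plus: "real n + 1 / real r = real (r * n + 1) / real r"
    using r by (simp add: field_simps)
  have minus: "real n - 1 / real r = real (r * n - 1) / real r"
    using r rn by (simp add: field_simps of_nat_diff)
  have coeff: "real r ^ (2 * n) * pade_coeff n \<alpha> k \<in> \<int>" if "k \<le> n" for k
  proof -
    have "real r ^ (2 * k) * ((real n + \<alpha>) gchoose k) \<in> \<int>"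
         "real r ^ (2 * (n - k)) * ((real n - \<alpha>) gchoose (n - k)) \<in> \<int>"
      using \<alpha> plus minus gbinomial_rational_Ints[OF r] by (auto simp del: of_nat_add of_nat_mult of_nat_Suc)
    then have "(real r ^ (2 * k) * ((real n + \<alpha>) gchoose k)) *
         (real r ^ (2 * (n - k)) * ((real n - \<alpha>) gchoose (n - k))) \<in> \<int>"
      by (rule Ints_mult)
    moreover have "real r ^ (2 * k) * real r ^ (2 * (n - k)) = real r ^ (2 * n)"
      using that by (simp flip: power_add distrib_left)
    ultimately show ?thesis by (simp add: pade_coeff_def mult_ac)
  qed
  have "real r ^ (2 * n) * (of_int U ^ n * pade n \<alpha> (of_int V / of_int U))
      = (\<Sum>k\<le>n. (real r ^ (2 * n) * pade_coeff n \<alpha> k) * of_int (V ^ k * U ^ (n - k)))"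
    unfolding pade_def sum_distrib_left
  proof (intro sum.cong refl)
    fix k assume "k \<in> {..n}"
    then have "(of_int U :: real) ^ n = of_int U ^ k * of_int U ^ (n - k)" by (simp flip: power_add)
    then show "real r ^ (2 * n) * (of_int U ^ n * (pade_coeff n \<alpha> k * (of_int V / of_int U) ^ k))
      = (real r ^ (2 * n) * pade_coeff n \<alpha> k) * of_int (V ^ k * U ^ (n - k))"
      using U by (simp add: power_divide)
  qed
  also have "\<dots> \<in> \<int>" by (intro Ints_sum Ints_mult coeff) auto
  finally show ?thesis .
qed

section \<open>The gap principle and the comparison of powers\<close>

lemma abs_diff_times_max_power_le:
  fixes X Y :: real
  assumes "X > 0" "Y > 0" "r > 0"
  shows "\<bar>X - Y\<bar> * max X Y ^ (r - 1) \<le> \<bar>X ^ r - Y ^ r\<bar>"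
proof -
  have *: "(X - Y) * X ^ (r - 1) \<le> X ^ r - Y ^ r" if "0 < Y" "Y \<le> X" for X Y :: real
  proof -
    have "Y * Y ^ (r - 1) \<le> Y * X ^ (r - 1)" using that by (intro mult_left_mono power_mono) auto
    then show ?thesis using \<open>r > 0\<close> by (simp add: left_diff_distrib power_eq_if)
  qed
  show ?thesis
  proof (cases "Y \<le> X")
    case True
    then have "Y ^ r \<le> X ^ r" using assms by (intro power_mono) auto
    then show ?thesis using *[of Y X] True assms by (simp add: max_def)
  next
    case False
    then have "X ^ r \<le> Y ^ r" using assms by (intro power_mono) auto
    then show ?thesis using *[of X Y] False assms by (simp add: max_def)
  qed
qed

text \<open>The determinant equals \<open>X (Y' - X') + X' (X - Y)\<close>, where both differences are small because
\<open>X\<^sup>r - Y\<^sup>r\<close> and \<open>X'\<^sup>r - Y'\<^sup>r\<close> are.\<close>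

lemma gap_principle:
  fixes X Y X' Y' c H :: real
  assumes pos: "X > 0" "Y > 0" "X' > 0" "Y' > 0" "r > 0"
    and sol: "\<bar>X ^ r - Y ^ r\<bar> \<le> c" "\<bar>X' ^ r - Y' ^ r\<bar> \<le> c"
    and le: "max X Y \<le> max X' Y'" and det: "H \<le> \<bar>X * Y' - X' * Y\<bar>"
  shows "H * max X Y ^ (r - 1) \<le> 2 * c * max X' Y'"
proof -
  define m T where "m = max X Y" and "T = max X' Y'"
  have m: "0 < m" "m \<le> T" "X \<le> m" "X' \<le> T" using pos le by (auto simp: m_def T_def)
  have c: "0 \<le> c" using sol(1) by linarith
  have d: "\<bar>X - Y\<bar> * m ^ (r - 1) \<le> c" "\<bar>X' - Y'\<bar> * T ^ (r - 1) \<le> c"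
    using abs_diff_times_max_power_le[of X Y r] abs_diff_times_max_power_le[of X' Y' r] pos sol
    by (auto simp: m_def T_def)
  have "X * Y' - X' * Y = X * (Y' - X') + X' * (X - Y)" by algebra
  then have "\<bar>X * Y' - X' * Y\<bar> \<le> \<bar>X * (Y' - X')\<bar> + \<bar>X' * (X - Y)\<bar>" by linarith
  also have "\<dots> \<le> m * \<bar>X' - Y'\<bar> + T * \<bar>X - Y\<bar>"
    unfolding abs_mult using pos m by (intro add_mono mult_mono) auto
  finally have "H * m ^ (r - 1) \<le> (m * \<bar>X' - Y'\<bar> + T * \<bar>X - Y\<bar>) * m ^ (r - 1)"
    using det m by (intro mult_right_mono) auto
  also have "\<dots> = m * (\<bar>X' - Y'\<bar> * m ^ (r - 1)) + T * (\<bar>X - Y\<bar> * m ^ (r - 1))"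
    by (simp add: algebra_simps)
  also have "\<dots> \<le> T * (\<bar>X' - Y'\<bar> * T ^ (r - 1)) + T * (\<bar>X - Y\<bar> * m ^ (r - 1))"
    using m by (intro add_mono mult_mono mult_left_mono power_mono) auto
  also have "\<dots> \<le> T * c + T * c"
    using m d by (intro add_mono mult_left_mono) auto
  finally show ?thesis by (simp add: m_def T_def algebra_simps)
qed

lemma power_le_power_of_large:
  fixes q M :: real
  assumes "q \<ge> 1" "q ^ 8 \<le> M" "i \<le> 8 * j"
  shows "q ^ i \<le> M ^ j"
proof -
  have "q ^ i \<le> q ^ (8 * j)" using assms by (intro power_increasing) auto
  also have "\<dots> = (q ^ 8) ^ j" by (rule power_mult)
  also have "\<dots> \<le> M ^ j" using assms by (intro power_mono) auto
  finally show ?thesis .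
qed

text \<open>In this lemma and the next, \<open>M\<close> stands for the scaled coordinate of a large solution and \<open>T\<close> for the height
of a later one. The assumption \<open>P\<close> is the bound for \<open>T\<close> obtained from the approximant of order \<open>n\<close>,
and the conclusions concern the order \<open>n + 1\<close>. Here the term \<open>(Y' - X') A\<close> becomes harmless. Both
proofs raise \<open>P\<close> to a power and replace powers of \<open>q\<close> by powers of \<open>M\<close> with an exponent eight times smaller; the
surplus exponent \<open>e\<close> is where \<open>r \<ge> 5\<close> enters.\<close>

lemma ladder_dominates_numerator:
  fixes q M T :: real and r n :: nat
  assumes q: "q \<ge> 1" and M: "q ^ 8 \<le> M" and T: "T > 0" and r: "r \<ge> 5"
    and P: "M ^ (r * Suc n) \<le> M * T * q ^ (2 * n + 1)"
  shows "q ^ (2 * n + 3) * M ^ (r * Suc n + 1) \<le> T ^ (r - 1)"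
proof -
  have M0: "M \<ge> 1" using q M one_le_power[OF q, of 8] by linarith
  define e where "e = r * ((r - 2) * Suc n - 1)"
  obtain s where s: "r = s + 5" using r by (metis le_Suc_ex add.commute)
  have e1: "(2 * n + 3) + (2 * n + 1) * (r - 1) \<le> 8 * e"
    unfolding e_def s by (simp add: algebra_simps)
  have e2: "(r * Suc n + 1) + (r - 1) + e = (r * Suc n) * (r - 1)"
    unfolding e_def s by (simp add: algebra_simps)
  define K where "K = M ^ (r - 1) * q ^ ((2 * n + 1) * (r - 1))"
  have K: "K > 0" using M0 q by (simp add: K_def)
  have "(q ^ (2 * n + 3) * M ^ (r * Suc n + 1)) * K
        = M ^ ((r * Suc n + 1) + (r - 1)) * q ^ ((2 * n + 3) + (2 * n + 1) * (r - 1))"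
    unfolding K_def power_add by (simp only: mult_ac)
  also have "\<dots> \<le> M ^ ((r * Suc n + 1) + (r - 1)) * M ^ e"
    using power_le_power_of_large[OF q M e1] M0 by (intro mult_left_mono) auto
  also have "\<dots> = (M ^ (r * Suc n)) ^ (r - 1)"
    by (simp only: power_add[symmetric] e2 power_mult)
  also have "\<dots> \<le> (M * T * q ^ (2 * n + 1)) ^ (r - 1)"
    using P M0 by (intro power_mono) auto
  also have "\<dots> = T ^ (r - 1) * K"
    unfolding K_def power_mult_distrib power_mult by (simp only: mult_ac)
  finally show ?thesis using K by simp
qed

text \<open>If \<open>D\<close> vanished for order \<open>n + 1\<close>, then \<open>T\<^sup>r\<close> would be at most the left-hand side. In the exponents
of \<open>M\<close>, the assumption gives about \<open>r (n + 1) - 1\<close> for \<open>T\<close>, against \<open>2 n + 3\<close> here.\<close>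

lemma ladder_dominates_inverse_remainder:
  fixes q M T :: real and r n :: nat
  assumes q: "q > 1" and M: "q ^ 8 \<le> M" and T: "T > 0" and r: "r \<ge> 5"
    and P: "M ^ (r * Suc n) \<le> M * T * q ^ (2 * n + 1)"
  shows "q ^ (2 * n + 3) * M ^ (r * (2 * n + 3)) < T ^ r"
proof -
  have q1: "q \<ge> 1" using q by simp
  have M0: "M \<ge> 1" using q1 M one_le_power[OF q1, of 8] by linarith
  define e where "e = r * ((r - 2) * Suc n - 2)"
  obtain s where s: "r = s + 5" using r by (metis le_Suc_ex add.commute)
  have e1: "Suc ((2 * n + 3) + (2 * n + 1) * r) \<le> 8 * e"
    unfolding e_def s by (simp add: algebra_simps)
  have e2: "r * (2 * n + 3) + r + e = (r * Suc n) * r"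
    unfolding e_def s by (simp add: algebra_simps)
  define K where "K = M ^ r * q ^ ((2 * n + 1) * r)"
  have K: "K > 0" using M0 q by (simp add: K_def)
  have "(q ^ (2 * n + 3) * M ^ (r * (2 * n + 3))) * K
        = M ^ (r * (2 * n + 3) + r) * q ^ ((2 * n + 3) + (2 * n + 1) * r)"
    unfolding K_def power_add by (simp only: mult_ac)
  also have "\<dots> < M ^ (r * (2 * n + 3) + r) * q ^ Suc ((2 * n + 3) + (2 * n + 1) * r)"
    using q M0 by (intro mult_strict_left_mono power_strict_increasing) auto
  also have "\<dots> \<le> M ^ (r * (2 * n + 3) + r) * M ^ e"
    using power_le_power_of_large[OF q1 M e1] M0 by (intro mult_left_mono) auto
  also have "\<dots> = (M ^ (r * Suc n)) ^ r"
    by (simp only: power_add[symmetric] e2 power_mult)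
  also have "\<dots> \<le> (M * T * q ^ (2 * n + 1)) ^ r"
    using P M0 by (intro power_mono) auto
  also have "\<dots> = T ^ r * K"
    unfolding K_def power_mult_distrib power_mult by (simp only: mult_ac)
  finally show ?thesis using K by simp
qed

section \<open>Exclusion of solutions beyond a large one\<close>

text \<open>The sign condition \<open>a x\<^sup>r < b y\<^sup>r\<close> puts \<open>w = b y\<^sup>r / (a x\<^sup>r)\<close> above 1; the other sign follows by
exchanging the roles of the two variables. The induction below is on the order \<open>n\<close> of the
approximant, and its base is the gap principle, which corresponds to the approximant \<open>1 / 1\<close>.\<close>

lemma no_solution_beyond_large_solution:
  fixes a b c x y x' y' :: int and p s :: real and r :: nat
  assumes r: "r \<ge> 5" and p: "p > 0" "p ^ r = of_int a" and s: "s > 0" "s ^ r = of_int b"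
    and H: "p * s \<ge> 1" and c: "c > 0" and pos: "x > 0" "y > 0" "x' > 0" "y' > 0"
    and near: "a * x ^ r < b * y ^ r" "b * y ^ r - a * x ^ r \<le> c"
    and sol': "\<bar>a * x' ^ r - b * y' ^ r\<bar> \<le> c"
    and distinct: "x * y' \<noteq> x' * y"
    and large: "(8 * real r * of_int c) ^ 8 \<le> p * of_int x"
    and later: "max (p * of_int x) (s * of_int y) \<le> max (p * of_int x') (s * of_int y')"
  shows False
proof -
  define q M Y X' Y' where "q = 8 * real r * of_int c" and "M = p * of_int x" and "Y = s * of_int y"
    and "X' = p * of_int x'" and "Y' = s * of_int y'"
  note defs = q_def M_def Y_def X'_def Y'_def
  define T \<delta> where "T = max X' Y'" and "\<delta> = \<bar>Y' - X'\<bar>"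
  define U V where "U = a * x ^ r" and "V = b * y ^ r"
  define w \<alpha> where "w = (of_int V / of_int U :: real)" and "\<alpha> = 1 / real r"
  have c1: "1 \<le> real_of_int c" using c by simp
  have q40: "40 * of_int c \<le> q" unfolding q_def using r c1 by (intro mult_right_mono) auto
  then have q1: "q \<ge> 1" "q \<ge> 40" using c1 by linarith+
  have Mq: "q ^ 8 \<le> M" using large by (simp add: defs)
  have qM: "q \<le> M" using power_le_power_of_large[OF q1(1) Mq, of 1 1] by simp
  have M1: "M > 1" using qM q1 by linarith
  have UM: "of_int U = M ^ r" and VY: "of_int V = Y ^ r"
    using p s by (simp_all add: U_def V_def defs power_mult_distrib)
  have pos': "M > 0" "Y > 0" "X' > 0" "Y' > 0" using pos p s by (simp_all add: defs)
  have T: "T > 0" "X' \<le> T" "M \<le> T" using later pos' by (auto simp: T_def defs)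
  have U: "U > 0" using UM pos' by (metis of_int_0_less_iff zero_less_power)
  have near': "1 \<le> V - U" "V - U \<le> c" using near by (auto simp: U_def V_def)
  have cU: "of_int c \<le> (of_int U :: real)"
  proof -
    have "of_int c \<le> M ^ 1" using q40 qM c1 unfolding power_one_right by linarith
    also have "\<dots> \<le> M ^ r" using M1 r by (intro power_increasing) auto
    finally show ?thesis by (simp add: UM)
  qed
  have w1: "w - 1 = of_int (V - U) / M ^ r"
    using U by (simp add: w_def UM[symmetric] field_simps)
  have w: "1 < w" "w \<le> 2"
  proof -
    have "0 < of_int (V - U) / M ^ r" using near' pos' by simp
    then show "1 < w" using w1 by linarith
    have "real_of_int (V - U) \<le> of_int c" using near' by (simp only: of_int_le_iff)
    then have "of_int (V - U) / M ^ r \<le> 1" using cU pos' by (simp add: UM)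
    then show "w \<le> 2" using w1 by linarith
  qed
  have wroot: "w powr \<alpha> = Y / M"
  proof -
    have "w = (Y / M) powr real r"
      using pos' by (simp add: w_def UM VY power_divide powr_realpow)
    then show ?thesis using r pos' by (simp add: powr_powr \<alpha>_def)
  qed
  have \<alpha>: "0 < \<alpha>" "\<alpha> \<le> 1 / 2" "\<bar>\<alpha>\<bar> \<le> 1" "\<bar>-\<alpha>\<bar> \<le> 1" using r by (simp_all add: \<alpha>_def field_simps)
  have sol'': "\<bar>X' ^ r - Y' ^ r\<bar> \<le> of_int c"
  proof -
    have "X' ^ r - Y' ^ r = of_int (a * x' ^ r - b * y' ^ r)"
      using p s by (simp add: defs power_mult_distrib)
    then show ?thesis using sol' by linarith
  qed
  have \<delta>: "\<delta> * T ^ (r - 1) \<le> of_int c" "0 \<le> \<delta>"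
    using abs_diff_times_max_power_le[of X' Y' r] sol'' pos' r
    by (auto simp: \<delta>_def T_def abs_minus_commute)
  \<comment> \<open>\<open>X'\<close> and \<open>Y'\<close> nearly agree, so either of them may replace the height up to a factor 2.\<close>
  have T2: "T \<le> 2 * X'"
  proof -
    have "M ^ 1 \<le> M ^ (r - 2)" using M1 r by (intro power_increasing) auto
    also have "\<dots> \<le> T ^ (r - 2)" using M1 T by (intro power_mono) auto
    finally have "2 * of_int c * T \<le> T ^ (r - 2) * T" using qM q40 T c1
      by (intro mult_right_mono) auto
    also have "\<dots> = T ^ (r - 1)" using r by (simp add: power_eq_if numeral_2_eq_2)
    finally have "\<delta> * (2 * of_int c * T) \<le> of_int c"
      using \<delta> by (meson mult_left_mono order_trans)
    then have "of_int c * (2 * \<delta> * T) \<le> of_int c * 1" by (simp add: mult_ac)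
    then have "2 * \<delta> * T \<le> 1" using c1 by (subst (asm) mult_le_cancel_left_pos) auto
    moreover have "\<delta> * 1 \<le> \<delta> * T" using T M1 \<delta>(2) by (intro mult_left_mono) auto
    ultimately have "2 * \<delta> \<le> T" using T M1 by linarith
    then show ?thesis unfolding \<delta>_def T_def by (auto simp: max_def split: if_splits)
  qed
  have P: "M ^ (r * Suc n) \<le> M * T * q ^ (2 * n + 1)" for n
  proof (induction n)
    case 0
    have "1 \<le> \<bar>x * y' - x' * y\<bar>" using distinct by simp
    then have "1 \<le> real_of_int \<bar>x * y' - x' * y\<bar>" by (simp only: of_int_1_le_iff)
    then have "p * s * 1 \<le> (p * s) * of_int \<bar>x * y' - x' * y\<bar>"
      using H by (intro mult_left_mono) auto
    also have "\<dots> = \<bar>M * Y' - X' * Y\<bar>"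
    proof -
      have "M * Y' - X' * Y = (p * s) * of_int (x * y' - x' * y)" by (simp add: defs algebra_simps)
      then show ?thesis using p(1) s(1) by (simp add: abs_mult)
    qed
    finally have det: "1 \<le> \<bar>M * Y' - X' * Y\<bar>" using H by simp
    have "\<bar>M ^ r - Y ^ r\<bar> \<le> of_int c"
      using near' unfolding UM[symmetric] VY[symmetric] by linarith
    then have "1 * max M Y ^ (r - 1) \<le> 2 * of_int c * max X' Y'"
      using pos' sol'' later det r by (intro gap_principle) (auto simp: defs)
    moreover have "M ^ (r - 1) \<le> max M Y ^ (r - 1)" using pos' by (intro power_mono) auto
    ultimately have "M ^ (r - 1) \<le> 2 * of_int c * T" by (simp add: T_def)
    also have "\<dots> \<le> q * T" using q40 c1 T by (intro mult_right_mono) auto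
    finally have "M * M ^ (r - 1) \<le> M * (q * T)" using pos' by (intro mult_left_mono) auto
    then show ?case using r by (simp add: power_eq_if mult_ac)
  next
    case (Suc m)
    define n A B F where "n = Suc m" and "A = pade n \<alpha> w" and "B = pade n (-\<alpha>) w"
      and "F = real r ^ (2 * n) * M ^ (r * n)"
    define R where "R = B * w powr \<alpha> - A"
    have A: "0 \<le> A" "A \<le> 8 ^ n" using \<alpha> w by (auto simp: A_def intro: pade_nonneg pade_upper)
    have R: "R \<le> (w - 1) ^ (2 * n + 1)" "\<alpha> / 2 ^ (5 * n + 2) * (w - 1) ^ (2 * n + 1) \<le> R"
      unfolding R_def A_def B_def using pade_remainder_bounds[OF \<alpha>(1,2) w] by auto
    have R_upper: "R \<le> of_int c ^ (2 * n + 1) / M ^ (r * (2 * n + 1))"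
    proof -
      have "(w - 1) ^ (2 * n + 1) \<le> (of_int c / M ^ r) ^ (2 * n + 1)"
        unfolding w1 using near' pos' by (intro power_mono divide_right_mono) auto
      then show ?thesis using R(1) unfolding power_divide power_mult by linarith
    qed
    \<comment> \<open>This uses that the nonzero integer \<open>V - U\<close> is at least 1.\<close>
    have R_lower: "1 / (real r * 2 ^ (5 * n + 2) * M ^ (r * (2 * n + 1))) \<le> R"
    proof -
      have "1 / (real r * 2 ^ (5 * n + 2) * M ^ (r * (2 * n + 1)))
          = \<alpha> / 2 ^ (5 * n + 2) * (1 / M ^ r) ^ (2 * n + 1)"
        by (simp only: \<alpha>_def power_one_over power_mult) simp
      also have "\<dots> \<le> \<alpha> / 2 ^ (5 * n + 2) * (w - 1) ^ (2 * n + 1)"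
        unfolding w1 using near' pos' \<alpha> by (intro power_mono mult_left_mono divide_right_mono) auto
      finally show ?thesis using R(2) by linarith
    qed
    have n2: "2 * n + 1 = 2 * m + 3" by (simp add: n_def)
    have FU: "real r ^ (2 * n) * (of_int U ^ n * z) = F * z" for z
      by (simp add: F_def UM power_mult)
    have "F * A \<in> \<int>" "F * B \<in> \<int>"
      using pade_Ints[of r n U \<alpha> V] pade_Ints[of r n U "-\<alpha>" V] r U
      unfolding FU w_def[symmetric] A_def[symmetric] B_def[symmetric]
      by (auto simp: \<alpha>_def n_def)
    then obtain IA IB where I: "F * A = of_int IA" "F * B = of_int IB" by (auto elim!: Ints_cases)
    \<comment> \<open>\<open>D\<close> is the numerator of the difference between \<open>y' / x'\<close> and the approximation
      \<open>y B / (x A)\<close> of \<open>(a / b)\<^sup>1\<^sup>/\<^sup>r\<close>.\<close>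
    define D where "D = y' * x * IA - x' * y * IB"
    have D: "(p * s) * of_int D = F * M * ((Y' - X') * A - X' * R)"
    proof -
      have "(p * s) * of_int D = Y' * M * (F * A) - X' * Y * (F * B)"
        unfolding D_def I by (simp add: defs algebra_simps)
      moreover have MR: "M * R = B * Y - A * M" using pos' by (simp add: R_def wroot field_simps)
      moreover have "F * M * ((Y' - X') * A - X' * R) = F * ((Y' - X') * A * M) - F * X' * (M * R)"
        by (simp add: algebra_simps)
      ultimately show ?thesis unfolding MR by (simp add: algebra_simps)
    qed
    have F: "F > 0" using r pos' by (simp add: F_def)
    show ?case
    proof (cases "D = 0")
      case True
      then have "(Y' - X') * A = X' * R" using D F pos' by simp
      moreover have "(Y' - X') * A \<le> \<delta> * A"
        unfolding \<delta>_def using A(1) by (rule mult_right_mono[OF abs_ge_self])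
      ultimately have "X' * R \<le> \<delta> * A" by simp
      also have "\<dots> \<le> \<delta> * 8 ^ n" using A \<delta> by (intro mult_left_mono) auto
      finally have 1: "X' * R \<le> \<delta> * 8 ^ n" .
      have R0: "0 < R" by (rule less_le_trans[OF _ R_lower]) (use r pos' in auto)
      have "T ^ r * R = T ^ (r - 1) * (T * R)" using r by (simp add: power_eq_if)
      also have "\<dots> \<le> T ^ (r - 1) * (2 * (\<delta> * 8 ^ n))"
      proof (intro mult_left_mono)
        have "T * R \<le> 2 * X' * R" using T2 R0 by (intro mult_right_mono) auto
        then show "T * R \<le> 2 * (\<delta> * 8 ^ n)" using 1 by linarith
      qed (use T in auto)
      also have "\<dots> = 2 * 8 ^ n * (\<delta> * T ^ (r - 1))" by simp
      also have "\<dots> \<le> 2 * 8 ^ n * of_int c" using \<delta> by (intro mult_left_mono) auto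
      finally have 2: "T ^ r * R \<le> 2 * 8 ^ n * of_int c" .
      define L where "L = real r * 2 ^ (5 * n + 2) * M ^ (r * (2 * n + 1))"
      have L: "L > 0" using r pos' by (simp add: L_def)
      have "T ^ r * (1 / L) \<le> T ^ r * R" using R_lower T unfolding L_def[symmetric]
        by (intro mult_left_mono) auto
      then have "T ^ r * (1 / L) \<le> 2 * 8 ^ n * of_int c" using 2 by linarith
      then have "T ^ r \<le> 2 * 8 ^ n * of_int c * L" using L by (simp add: field_simps)
      also have "\<dots> = (q * (2 ^ 8) ^ n) * M ^ (r * (2 * n + 1))"
      proof -
        have "(8 ^ n * 2 ^ (5 * n) :: real) = (2 ^ 8) ^ n"
          by (simp add: power_mult power_mult_distrib[symmetric])
        then show ?thesis by (simp add: L_def q_def power_add mult_ac)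
      qed
      also have "\<dots> \<le> (q * (q ^ 2) ^ n) * M ^ (r * (2 * n + 1))"
      proof -
        have "(2 ^ 8 :: real) \<le> 40 ^ 2" by simp
        also have "\<dots> \<le> q ^ 2" using q1 by (intro power_mono) auto
        finally show ?thesis using q1 pos' by (intro mult_right_mono mult_left_mono power_mono) auto
      qed
      also have "\<dots> = q ^ (2 * m + 3) * M ^ (r * (2 * m + 3))"
      proof -
        have "q * (q ^ 2) ^ n = q ^ (2 * n + 1)" by (simp add: power_mult)
        then show ?thesis unfolding n2 by simp
      qed
      finally have "T ^ r \<le> q ^ (2 * m + 3) * M ^ (r * (2 * m + 3))" .
      moreover have "q ^ (2 * m + 3) * M ^ (r * (2 * m + 3)) < T ^ r"
        using q1 by (intro ladder_dominates_inverse_remainder[OF _ Mq T(1) r Suc.IH]) auto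
      ultimately show ?thesis by simp
    next
      case False
      \<comment> \<open>Of the two terms that bound this product, the first turns out to be at most 1/2, so the
      second is at least 1/2.\<close>
      have "1 * 1 \<le> (p * s) * of_int \<bar>D\<bar>" using H False by (intro mult_mono) auto
      also have "\<dots> = \<bar>F * M * ((Y' - X') * A - X' * R)\<bar>" unfolding D[symmetric] using p(1) s(1) by (simp add: abs_mult)
      also have "\<dots> = F * M * \<bar>(Y' - X') * A - X' * R\<bar>" using F pos' by (simp add: abs_mult)
      also have "\<dots> \<le> F * M * (\<delta> * 8 ^ n + T * (of_int c ^ (2 * n + 1) / M ^ (r * (2 * n + 1))))"
      proof (intro mult_left_mono)
        have R0: "0 < R" by (rule less_le_trans[OF _ R_lower]) (use r pos' in auto)
        have "\<bar>(Y' - X') * A - X' * R\<bar> \<le> \<bar>(Y' - X') * A\<bar> + \<bar>X' * R\<bar>" by linarith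
        also have "\<dots> \<le> \<delta> * 8 ^ n + T * (of_int c ^ (2 * n + 1) / M ^ (r * (2 * n + 1)))"
          unfolding abs_mult \<delta>_def[symmetric] using A \<delta> T pos' R0 R_upper
          by (intro add_mono mult_mono) auto
        finally show "\<bar>(Y' - X') * A - X' * R\<bar>
            \<le> \<delta> * 8 ^ n + T * (of_int c ^ (2 * n + 1) / M ^ (r * (2 * n + 1)))" .
      qed (use F pos' in auto)
      also have "\<dots> = F * M * 8 ^ n * \<delta>
           + F * M * (T * (of_int c ^ (2 * n + 1) / M ^ (r * (2 * n + 1))))"
        by (simp add: algebra_simps)
      finally have sum: "1 \<le> \<dots>" by simp
      \<comment> \<open>Used with \<open>z = 1\<close> for the first term and with \<open>z = c\<^sup>2\<close> for the second.\<close>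
      have rq: "(real r ^ 2) ^ n * 2 * 8 ^ n * of_int c * z ^ n \<le> q ^ (2 * n + 1)" 
        if "0 \<le> z" "z \<le> of_int c ^ 2" for z :: real
      proof -
        have "(real r ^ 2) ^ n * 2 * 8 ^ n * of_int c * z ^ n = (8 * real r ^ 2 * z) ^ n * (2 * of_int c)"
          by (simp add: power_mult_distrib)
        also have "\<dots> \<le> (q ^ 2) ^ n * q"
        proof (intro mult_mono power_mono)
          have "8 * real r ^ 2 * z \<le> 64 * real r ^ 2 * of_int c ^ 2"
            using that by (intro mult_mono) auto
          then show "8 * real r ^ 2 * z \<le> q ^ 2" by (simp add: q_def power_mult_distrib)
        qed (use q40 q1 c1 that in auto)
        also have "\<dots> = q ^ (2 * n + 1)" by (simp add: power_mult)
        finally show ?thesis .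
      qed
      have "2 * (F * M * 8 ^ n * \<delta>) \<le> 1"
      proof -
        have "F * M * 8 ^ n * (2 * of_int c)
            = ((real r ^ 2) ^ n * 2 * 8 ^ n * of_int c * 1 ^ n) * M ^ (r * n + 1)"
          by (simp add: F_def power_mult)
        also have "\<dots> \<le> q ^ (2 * n + 1) * M ^ (r * n + 1)"
          using c1 pos' by (intro mult_right_mono rq) auto
        also have "\<dots> = q ^ (2 * m + 3) * M ^ (r * Suc m + 1)" unfolding n2 by (simp only: n_def)
        also have "\<dots> \<le> T ^ (r - 1)" by (rule ladder_dominates_numerator[OF q1(1) Mq T(1) r Suc.IH])
        finally have "F * M * 8 ^ n * (2 * of_int c) * \<delta> \<le> T ^ (r - 1) * \<delta>"
          using \<delta> by (intro mult_right_mono) auto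
        then have "of_int c * (2 * (F * M * 8 ^ n * \<delta>)) \<le> of_int c * 1" using \<delta>(1) by (simp add: mult_ac)
        then show ?thesis using c1 by (subst (asm) mult_le_cancel_left_pos) auto
      qed
      then have "1 \<le> 2 * (F * M * (T * (of_int c ^ (2 * n + 1) / M ^ (r * (2 * n + 1)))))"
        using sum by linarith
      also have "\<dots> = (real r ^ 2) ^ n * 2 * of_int c ^ (2 * n + 1) * M * T / M ^ (r * Suc n)"
      proof -
        have "M ^ (r * (2 * n + 1)) = M ^ (r * n) * M ^ (r * Suc n)"
        proof -
          have "r * (2 * n + 1) = r * n + r * Suc n" by simp
          then show ?thesis by (simp only: power_add)
        qed
        then show ?thesis using pos' by (simp add: F_def power_mult)
      qed
      finally have "M ^ (r * Suc n) \<le> (real r ^ 2) ^ n * 2 * of_int c ^ (2 * n + 1) * M * T"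
        using pos' by (simp add: field_simps)
      also have "\<dots> \<le> q ^ (2 * n + 1) * M * T"
      proof (intro mult_right_mono)
        have "(real r ^ 2) ^ n * 2 * of_int c ^ (2 * n + 1)
            = ((real r ^ 2) ^ n * 2 * of_int c * (of_int c ^ 2) ^ n) * 1"
          by (simp add: power_mult)
        also have "\<dots> \<le> ((real r ^ 2) ^ n * 2 * of_int c * (of_int c ^ 2) ^ n) * 8 ^ n"
          using c1 by (intro mult_left_mono) auto
        also have "\<dots> = (real r ^ 2) ^ n * 2 * 8 ^ n * of_int c * (of_int c ^ 2) ^ n" by simp
        also have "\<dots> \<le> q ^ (2 * n + 1)" by (intro rq) auto
        finally show "(real r ^ 2) ^ n * 2 * of_int c ^ (2 * n + 1) \<le> q ^ (2 * n + 1)" .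
      qed (use pos' T in auto)
      finally show ?thesis by (simp add: n_def mult_ac)
    qed
  qed
  have "M ^ n \<le> T" for n
  proof -
    obtain k where k: "r = k + 5" using r by (metis le_Suc_ex add.commute)
    have "q ^ (2 * n + 1) \<le> M ^ Suc n"
      by (rule power_le_power_of_large[OF q1(1) Mq]) simp
    then have "M ^ (r * Suc n) \<le> M * T * M ^ Suc n"
      using P[of n] T pos' by (meson mult_left_mono mult_nonneg_nonneg order_trans less_imp_le)
    moreover have "M ^ (n + (n + 2)) \<le> M ^ (r * Suc n)"
      using M1 by (intro power_increasing) (auto simp: k add_mult_distrib)
    ultimately have "M ^ n * M ^ (n + 2) \<le> T * M ^ (n + 2)"
      by (simp add: power_add mult_ac power2_eq_square)
    then show ?thesis using pos' by simp
  qed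
  moreover obtain n where "T < M ^ n" using real_arch_pow[OF M1] by blast
  ultimately show False by (meson not_le)
qed

section \<open>Four solutions contradict the size of the coefficients\<close>

lemma coprime_pair_eq:
  fixes x y x' y' :: int
  assumes "coprime x y" "coprime x' y'" "x > 0" "y > 0" "x' > 0" "y' > 0" "x * y' = x' * y"
  shows "x = x' \<and> y = y'"
proof -
  have "x dvd x'" using assms(1,7) by (metis coprime_dvd_mult_left_iff dvd_triv_left)
  moreover have "x' dvd x" using assms(2,7) by (metis coprime_dvd_mult_left_iff dvd_triv_left)
  ultimately have "x = x'" using assms by (simp add: zdvd_antisym_nonneg)
  then show ?thesis using assms by simp
qed

text \<open>The exponents simplify by \<open>7 r / (r - 4) \<ge> 7\<close> and \<open>(r\<^sup>2 + r + 2) / (r (r - 4)) \<ge> 18 / r\<close>. The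
latter amounts to \<open>r\<^sup>2 - 17 r + 74 \<ge> 0\<close>, a quadratic without real zeros. An integer divided by \<open>r\<close> as
lower bound keeps the exponents of the \<open>r\<close>-th power integral.\<close>

lemma coefficient_bound_imp_power_bound:
  fixes C P :: real
  assumes r: "r \<ge> 5" and C: "C \<ge> 1"
    and P: "2 ^ r * real r powr (7 * real r / (real r - 4)) *
           C powr (2 + ((real r)^2 + real r + 2) / (real r * (real r - 4))) \<le> P"
  shows "2 ^ r\<^sup>2 * real r ^ (7 * r) * C ^ (2 * r + 18) \<le> P ^ r"
proof -
  have r5: "real r \<ge> 5" using r by simp
  have "0 \<le> (real r - 17 / 2)\<^sup>2" by simp
  then have "18 * (real r - 4) \<le> (real r)\<^sup>2 + real r + 2"
    by (simp add: power2_eq_square algebra_simps)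
  then have e1: "18 / real r \<le> ((real r)\<^sup>2 + real r + 2) / (real r * (real r - 4))"
  proof -
    have "18 / real r = 18 * (real r - 4) / (real r * (real r - 4))"
      by (subst mult_divide_mult_cancel_right) (use r5 in auto)
    then show ?thesis using \<open>18 * (real r - 4) \<le> _\<close> r5 by (simp only:) (intro divide_right_mono; simp)
  qed
  have e2: "7 \<le> 7 * real r / (real r - 4)" using r5 by (simp add: field_simps)
  have "2 ^ r * real r powr 7 * C powr (2 + 18 / real r)
     \<le> 2 ^ r * real r powr (7 * real r / (real r - 4)) *
           C powr (2 + ((real r)^2 + real r + 2) / (real r * (real r - 4)))"
    using e1 e2 r5 C by (intro mult_mono powr_mono) auto
  then have "2 ^ r * real r powr 7 * C powr (2 + 18 / real r) \<le> P" using P by linarith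
  then have "(2 ^ r * real r powr 7 * C powr (2 + 18 / real r)) ^ r \<le> P ^ r"
    by (intro power_mono) auto
  moreover have "(C powr (2 + 18 / real r)) ^ r = C ^ (2 * r + 18)"
  proof -
    have "(C powr (2 + 18 / real r)) ^ r = C powr (real r * (2 + 18 / real r))"
      using C by (simp add: powr_power)
    also have "real r * (2 + 18 / real r) = real (2 * r + 18)" using r5 by (simp add: field_simps)
    finally show ?thesis using C by (simp only: powr_realpow)
  qed
  moreover have "real r powr 7 = real r ^ 7" using powr_realpow[of "real r" 7] r5 by simp
  ultimately show ?thesis
    by (simp add: power_mult_distrib power_mult power2_eq_square)
qed

text \<open>Substituting \<open>m1\<^sup>2 \<ge> H\<close> into the two gaps gives \<open>H\<^sup>r\<^sup>*\<^sup>r \<le> (2 C)\<^sup>2\<^sup>r m3\<^sup>2\<close>. The hypothesis \<open>big\<close> then leaves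
at least \<open>2\<^sup>r\<^sup>*\<^sup>r\<^sup>-\<^sup>2\<^sup>r r\<^sup>7\<^sup>r C\<^sup>1\<^sup>8\<close> for \<open>m3\<^sup>2\<close>, and surplus factors \<open>r \<ge> 2\<^sup>2\<close> pay for the powers of 2.\<close>

lemma third_height_large:
  fixes H m1 m2 m3 C :: real and r :: nat
  assumes r: "r \<ge> 5" and C: "C \<ge> 1" and H: "H \<ge> 1" and m: "m1 > 0" "m2 > 0" "m3 > 0"
    and m1: "H \<le> m1\<^sup>2"
    and gap: "H * m1 ^ (r - 1) \<le> 2 * C * m2" "H * m2 ^ (r - 1) \<le> 2 * C * m3"
    and big: "2 ^ r\<^sup>2 * real r ^ (7 * r) * C ^ (2 * r + 18) \<le> (H ^ r) ^ r"
  shows "2 * (8 * real r * C) ^ 8 \<le> m3"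
proof -
  obtain k where k: "r = Suc k" using r by (cases r) auto
  have H0: "H > 0" using H by simp
  have "H ^ (k + 2) = H\<^sup>2 * H ^ k" by (simp add: power_add mult.commute power2_eq_square)
  also have "\<dots> \<le> H\<^sup>2 * (m1\<^sup>2) ^ k" using m1 H0 by (intro mult_left_mono power_mono) auto
  also have "\<dots> = (H * m1 ^ k)\<^sup>2" by (simp add: power_mult_distrib mult.commute flip: power_mult)
  also have "\<dots> \<le> (2 * C * m2)\<^sup>2" using gap(1) H0 m by (intro power_mono) (auto simp: k)
  finally have 1: "H ^ (k + 2) \<le> (2 * C * m2)\<^sup>2" .
  have "r * r = 2 * k + 1 + k\<^sup>2" by (simp add: k power2_eq_square)
  then have "(H ^ r) ^ r = H ^ (2 * k + 1 + k\<^sup>2)" by (simp only: power_mult[symmetric])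
  also have "\<dots> \<le> H ^ (2 + (k + 2) * k)"
    using H by (intro power_increasing) (auto simp: power2_eq_square)
  also have "\<dots> = H\<^sup>2 * (H ^ (k + 2)) ^ k" by (simp only: power_add power_mult)
  also have "\<dots> \<le> H\<^sup>2 * ((2 * C * m2)\<^sup>2) ^ k"
    using 1 H0 by (intro mult_left_mono power_mono) auto
  also have "((2 * C * m2)\<^sup>2) ^ k = ((2 * C) ^ k * m2 ^ k)\<^sup>2"
    by (simp only: power_mult_distrib power_mult[symmetric] mult.commute[of 2 k])
  also have "H\<^sup>2 * \<dots> = ((2 * C) ^ k)\<^sup>2 * (H * m2 ^ k)\<^sup>2"
    by (simp only: power_mult_distrib mult_ac)
  also have "\<dots> \<le> ((2 * C) ^ k)\<^sup>2 * (2 * C * m3)\<^sup>2"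
    using gap(2) H0 m C by (intro mult_left_mono power_mono) (auto simp: k)
  also have "\<dots> = (2 * C) ^ (2 * r) * m3\<^sup>2"
  proof -
    have "2 * r = k * 2 + 2" by (simp add: k)
    then have "(2 * C) ^ (2 * r) = ((2 * C) ^ k)\<^sup>2 * (2 * C)\<^sup>2"
      by (simp only: power_add power_mult)
    then show ?thesis by (simp only: power_mult_distrib mult.assoc)
  qed
  finally have 2: "(H ^ r) ^ r \<le> (2 * C) ^ (2 * r) * m3\<^sup>2" .
  define Q where "Q = 2 * (8 * real r * C) ^ 8"
  have "(2 * C) ^ (2 * r) * Q\<^sup>2 = 2 ^ (2 * r + 50) * real r ^ 16 * C ^ (2 * r + 16)"
    by (simp add: Q_def power_mult_distrib power_add flip: power_mult)
  also have "\<dots> \<le> 2 ^ (r\<^sup>2 + 14 * r - 32) * real r ^ 16 * C ^ (2 * r + 18)"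
  proof -
    obtain j where j: "r = j + 5" using r by (metis le_Suc_ex add.commute)
    have "2 * r + 50 \<le> r\<^sup>2 + 14 * r - 32" by (simp add: j power2_eq_square algebra_simps)
    then show ?thesis using C r by (intro mult_mono power_increasing) auto
  qed
  also have "\<dots> = 2 ^ r\<^sup>2 * (2 ^ 2) ^ (7 * r - 16) * real r ^ 16 * C ^ (2 * r + 18)"
  proof -
    have "r\<^sup>2 + 14 * r - 32 = r\<^sup>2 + 2 * (7 * r - 16)" using r by simp
    then show ?thesis by (simp only: power_add power_mult)
  qed
  also have "\<dots> \<le> 2 ^ r\<^sup>2 * real r ^ (7 * r - 16) * real r ^ 16 * C ^ (2 * r + 18)"
    using r C by (intro mult_right_mono mult_left_mono power_mono) auto
  also have "\<dots> = 2 ^ r\<^sup>2 * real r ^ (7 * r) * C ^ (2 * r + 18)"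
    using r by (simp add: mult.assoc flip: power_add)
  also have "\<dots> \<le> (2 * C) ^ (2 * r) * m3\<^sup>2" using big 2 by linarith
  finally have "Q\<^sup>2 \<le> m3\<^sup>2" using C by simp
  then show ?thesis unfolding Q_def[symmetric] using m by (simp add: power2_le_iff_abs_le)
qed

text \<open>Scaling the coordinates by the roots of \<open>a\<close> and \<open>b\<close> turns the form \<open>a x\<^sup>r - b y\<^sup>r\<close> into
\<open>X\<^sup>r - Y\<^sup>r\<close>, so that the two coordinates of a solution are nearly equal.\<close>

definition height :: "int \<Rightarrow> int \<Rightarrow> nat \<Rightarrow> int \<times> int \<Rightarrow> real" where
  "height a b r = (\<lambda>(x, y). max (root r (of_int a) * of_int x) (root r (of_int b) * of_int y))"

definition solutions :: "int \<Rightarrow> int \<Rightarrow> int \<Rightarrow> nat \<Rightarrow> (int \<times> int) set" where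
  "solutions a b c r = {(x, y). x > 0 \<and> y > 0 \<and> primitive (x, y) \<and>
                   0 < \<bar>a * x ^ r - b * y ^ r\<bar> \<and> \<bar>a * x ^ r - b * y ^ r\<bar> \<le> c}"

lemma root_product_ge_1:
  assumes "a > 0" "b > 0" "r > 0"
  shows "root r (real_of_int a) * root r (real_of_int b) \<ge> 1"
proof -
  have "1 * 1 \<le> root r (real_of_int a) * root r (real_of_int b)"
    using assms by (intro mult_mono) auto
  then show ?thesis by simp
qed

lemma solutions_cross_neq:
  assumes "(x, y) \<in> solutions a b c r" "(x', y') \<in> solutions a b c r" "(x, y) \<noteq> (x', y')"
  shows "x * y' \<noteq> x' * y"
  using assms coprime_pair_eq[of x y x' y']
  by (auto simp: solutions_def primitive_def coprime_iff_gcd_eq_1)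

lemma solutions_gap:
  assumes ab: "a > 0" "b > 0" "r \<ge> 5"
    and sol: "s \<in> solutions a b c r" "s' \<in> solutions a b c r" "s \<noteq> s'"
    and le: "height a b r s \<le> height a b r s'"
  shows "root r (of_int a) * root r (of_int b) * height a b r s ^ (r - 1)
           \<le> 2 * of_int c * height a b r s'"
proof -
  obtain x y x' y' where s: "s = (x, y)" "s' = (x', y')" by (cases s, cases s')
  define p t where "p = root r (real_of_int a)" and "t = root r (real_of_int b)"
  have pt: "p > 0" "t > 0" "p ^ r = of_int a" "t ^ r = of_int b" using ab by (auto simp: p_def t_def)
  have near: "\<bar>(p * of_int u) ^ r - (t * of_int v) ^ r\<bar> \<le> real_of_int c"
    if "(u, v) \<in> solutions a b c r" for u v
  proof -
    have "(p * of_int u) ^ r - (t * of_int v) ^ r = of_int (a * u ^ r - b * v ^ r)"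
      by (simp add: power_mult_distrib pt)
    then show ?thesis using that by (auto simp: solutions_def simp del: of_int_diff)
  qed
  have "1 \<le> \<bar>x * y' - x' * y\<bar>" using solutions_cross_neq[of x y a b c r x' y'] sol by (simp add: s)
  then have "1 \<le> real_of_int \<bar>x * y' - x' * y\<bar>" by (simp only: of_int_1_le_iff)
  then have "p * t * 1 \<le> p * t * real_of_int \<bar>x * y' - x' * y\<bar>" using pt by (intro mult_left_mono) auto
  also have "\<dots> = \<bar>(p * of_int x) * (t * of_int y') - (p * of_int x') * (t * of_int y)\<bar>"
  proof -
    have "(p * of_int x) * (t * of_int y') - (p * of_int x') * (t * of_int y)
        = p * t * of_int (x * y' - x' * y)" by (simp add: algebra_simps)
    then show ?thesis using pt by (simp add: abs_mult)
  qed
  finally have "p * t * max (p * of_int x) (t * of_int y) ^ (r - 1)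
        \<le> 2 * of_int c * max (p * of_int x') (t * of_int y')"
    using sol near le ab pt
    by (intro gap_principle) (auto simp: s height_def p_def[symmetric] t_def[symmetric] solutions_def)
  then show ?thesis by (simp add: s height_def p_def t_def)
qed

text \<open>A lower bound for the larger coordinate of \<open>s\<close> passes to both coordinates at the cost of the factor 2,
since the two differ by very little; this allows either variable to play the first role.\<close>

lemma no_fourth_solution:
  assumes ab: "a > 0" "b > 0" "c > 0" "r \<ge> 5"
    and sol: "s \<in> solutions a b c r" "s' \<in> solutions a b c r" "s \<noteq> s'"
    and le: "height a b r s \<le> height a b r s'"
    and large: "2 * (8 * real r * of_int c) ^ 8 \<le> height a b r s"
  shows False
proof -
  obtain x y x' y' where s: "s = (x, y)" "s' = (x', y')" by (cases s, cases s')
  define p t where "p = root r (real_of_int a)" and "t = root r (real_of_int b)"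
  have pt: "p > 0" "t > 0" "p ^ r = of_int a" "t ^ r = of_int b" using ab by (auto simp: p_def t_def)
  define L where "L = (8 * real r * of_int c) ^ 8"
  have c1: "1 \<le> real_of_int c" using ab by simp
  have "8 * 5 * real_of_int c \<le> 8 * real r * of_int c" using ab by (intro mult_right_mono) auto
  moreover have "(8 * real r * of_int c) ^ 1 \<le> L" 
    unfolding L_def using calculation c1 by (intro power_increasing) linarith+
  ultimately have cL: "of_int c \<le> L" "1 \<le> L" using c1 unfolding power_one_right by linarith+
  define X Y where "X = p * of_int x" and "Y = t * of_int y"
  have pos: "x > 0" "y > 0" "x' > 0" "y' > 0" "X > 0" "Y > 0"
    using sol pt by (auto simp: s solutions_def X_def Y_def)
  have big: "2 * L \<le> max X Y"
    using large by (simp add: s height_def L_def X_def Y_def p_def t_def)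
  have "\<bar>X - Y\<bar> * max X Y ^ (r - 1) \<le> \<bar>X ^ r - Y ^ r\<bar>"
    using pos ab by (intro abs_diff_times_max_power_le) auto
  also have "X ^ r - Y ^ r = of_int (a * x ^ r - b * y ^ r)"
    by (simp add: power_mult_distrib pt X_def Y_def)
  also have "\<bar>real_of_int (a * x ^ r - b * y ^ r)\<bar> \<le> of_int c"
    using sol(1) by (auto simp: s solutions_def simp del: of_int_diff)
  finally have "\<bar>X - Y\<bar> * max X Y ^ (r - 1) \<le> L" using cL by linarith
  moreover have "\<bar>X - Y\<bar> * 1 \<le> \<bar>X - Y\<bar> * max X Y ^ (r - 1)"
    using big cL by (intro mult_left_mono one_le_power) auto
  ultimately have "\<bar>X - Y\<bar> * 1 \<le> L" by (rule order_trans[rotated])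
  then have "\<bar>X - Y\<bar> \<le> L" by simp
  then have min: "L \<le> X" "L \<le> Y" using big by (auto simp: max_def split: if_splits)
  have H: "p * t \<ge> 1" using root_product_ge_1 ab by (simp add: p_def t_def)
  have cross: "x * y' \<noteq> x' * y" using solutions_cross_neq sol unfolding s by blast
  have le': "max (p * of_int x) (t * of_int y) \<le> max (p * of_int x') (t * of_int y')"
    using le by (simp add: s height_def p_def t_def)
  have sols: "0 < \<bar>a * x ^ r - b * y ^ r\<bar>" "\<bar>a * x ^ r - b * y ^ r\<bar> \<le> c"
    "\<bar>a * x' ^ r - b * y' ^ r\<bar> \<le> c"
    using sol by (auto simp: s solutions_def)
  show False
  proof (cases "a * x ^ r < b * y ^ r")
    case True
    show False
      by (rule no_solution_beyond_large_solution[of r p a t b c x y x' y'])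
        (use True ab pt H pos sols cross le' min in \<open>auto simp: L_def X_def\<close>)
  next
    case False
    show False
      by (rule no_solution_beyond_large_solution[of r t b p a c y x y' x'])
        (use False ab pt H pos sols cross le' min in \<open>auto simp: L_def Y_def max.commute mult.commute abs_minus_commute\<close>)
  qed
qed

lemma four_distinct_sorted:
  fixes f :: "'a \<Rightarrow> real"
  assumes "\<not> (finite S \<and> card S \<le> 3)"
  obtains s1 s2 s3 s4 where "{s1, s2, s3, s4} \<subseteq> S" "distinct [s1, s2, s3, s4]"
    "f s1 \<le> f s2" "f s2 \<le> f s3" "f s3 \<le> f s4"
proof -
  obtain A where A: "A \<subseteq> S" "finite A" "card A = 4"
  proof (cases "finite S")
    case True
    then show ?thesis using assms that obtain_subset_with_card_n[of 4 S] by auto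
  next
    case False
    then show ?thesis using that infinite_arbitrarily_large[of S 4] by blast
  qed
  obtain l where l: "set l = A" "distinct l" using finite_distinct_list[OF A(2)] by blast
  define k where "k = sort_key f l"
  have k: "set k = A" "distinct k" "sorted (map f k)" "length k = 4"
    using l A(3) distinct_card[OF l(2)] by (auto simp: k_def)
  then obtain s1 s2 s3 s4 where "k = [s1, s2, s3, s4]"
    by (auto simp: numeral_eq_Suc length_Suc_conv)
  then show ?thesis using that k A by auto
qed

theorem theorem1p1:
  fixes a b c :: int and r :: nat
  assumes "a > 0" and "b > 0" and "c > 0" and "r \<ge> 5"
    and "real_of_int (a * b) \<ge>
           2 ^ r * real r powr (7 * real r / (real r - 4)) *
           real_of_int c powr (2 + ((real r)^2 + real r + 2) / (real r * (real r - 4)))"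
  defines "S \<equiv> {(x :: int, y :: int). x > 0 \<and> y > 0 \<and> primitive (x, y) \<and>
                   0 < \<bar>a * x ^ r - b * y ^ r\<bar> \<and> \<bar>a * x ^ r - b * y ^ r\<bar> \<le> c}"
  shows "finite S \<and> card S \<le> 3"
proof (rule ccontr)
  assume "\<not> (finite S \<and> card S \<le> 3)"
  then obtain s1 s2 s3 s4 where s: "{s1, s2, s3, s4} \<subseteq> S" "distinct [s1, s2, s3, s4]"
    and le: "height a b r s1 \<le> height a b r s2" "height a b r s2 \<le> height a b r s3"
      "height a b r s3 \<le> height a b r s4"
    by (rule four_distinct_sorted)
  have S: "S = solutions a b c r" by (simp add: S_def solutions_def)
  define H where "H = root r (real_of_int a) * root r (real_of_int b)"
  have H: "H \<ge> 1" using root_product_ge_1 assms by (simp add: H_def)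
  have Hr: "H ^ r = real_of_int (a * b)" using assms by (simp add: H_def power_mult_distrib)
  have pos: "height a b r t > 0 \<and> H \<le> (height a b r t)\<^sup>2" if "t \<in> S" for t
  proof -
    obtain x y where t: "t = (x, y)" by (cases t)
    define X Y where "X = root r (real_of_int a) * of_int x" and "Y = root r (real_of_int b) * of_int y"
    have xy: "x \<ge> 1" "y \<ge> 1" using that by (auto simp: S_def t)
    have XY: "X > 0" "Y > 0" using xy assms by (auto simp: X_def Y_def)
    have "1 * 1 \<le> real_of_int x * real_of_int y" using xy by (intro mult_mono) auto
    then have "H * 1 \<le> H * (real_of_int x * real_of_int y)" using H by (intro mult_left_mono) auto
    also have "\<dots> = X * Y" by (simp add: H_def X_def Y_def)
    also have "\<dots> \<le> max X Y * max X Y" using XY by (intro mult_mono) auto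
    finally show ?thesis using XY by (auto simp: t height_def X_def[symmetric] Y_def[symmetric] power2_eq_square)
  qed
  have "2 * (8 * real r * of_int c) ^ 8 \<le> height a b r s3"
  proof (rule third_height_large[where H = H])
    show "2 ^ r\<^sup>2 * real r ^ (7 * r) * real_of_int c ^ (2 * r + 18) \<le> (H ^ r) ^ r"
      unfolding Hr using assms by (intro coefficient_bound_imp_power_bound) auto
    show "H * height a b r s1 ^ (r - 1) \<le> 2 * real_of_int c * height a b r s2"
      "H * height a b r s2 ^ (r - 1) \<le> 2 * real_of_int c * height a b r s3"
      unfolding H_def using s le assms(1,2,4) by (intro solutions_gap; auto simp: S)+
  qed (use pos s H assms in auto)
  then show False
    using no_fourth_solution[of a b c r s3 s4] s le assms(1-4) by (auto simp: S)
qed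

end
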